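(* For any $\epsilon,\delta>0$, any streaming algorithm which, given a stream of $n$ axis-parallel $w$-by-$w$ squares (two-dimensional $l_\infty$ balls) all contained in a $(2+\delta)w$-by-$(2+\delta)w$ region, achieves a $(\frac{3}{2}-\epsilon)$-approximation to $\alpha(G)$ with constant probability of success requires $\Omega(n)$ space.
   Context: The squares are given as an implicit vertex stream: a sequence of centers (and the common side length) with integer coordinates of polylogarithmic bit-length, read once; $G$ is their intersection graph (one vertex per square, edges between intersecting closed squares). $\alpha(G)$ is the maximum size of an independent set; a $c$-approximation to $\alpha(G)$ is a value $\gamma$ with $\frac{1}{c}\alpha(G)\le\gamma\le\alpha(G)$. *)

theory Defs
  imports "HOL-Probability.Probability" "HOL-Library.Landau_Symbols" "HOL-Library.Log_Nat"
begin

definition independent_set :: "'v set \<Rightarrow> 'v set set \<Rightarrow> 'v set \<Rightarrow> bool" where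
  "independent_set V E I \<longleftrightarrow> I \<subseteq> V \<and> (\<forall>u\<in>I. \<forall>v\<in>I. {u, v} \<notin> E)"

definition independence_number :: "'v set \<Rightarrow> 'v set set \<Rightarrow> nat" where
  "independence_number V E = Max (card ` {I. independent_set V E I})"

definition square :: "int \<Rightarrow> int \<times> int \<Rightarrow> (real \<times> real) set" where
  "square w c =
     {real_of_int (fst c) - real_of_int w / 2 .. real_of_int (fst c) + real_of_int w / 2} \<times>
     {real_of_int (snd c) - real_of_int w / 2 .. real_of_int (snd c) + real_of_int w / 2}"

text \<open>The vertices of the intersection graph are the positions in the stream, so a square that
  occurs several times contributes several (pairwise adjacent) vertices.\<close>

definition intersection_edges :: "int \<Rightarrow> (int \<times> int) list \<Rightarrow> nat set set" where
  "intersection_edges w cs =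
     {{i, j} | i j. i < length cs \<and> j < length cs \<and> i \<noteq> j \<and>
                    square w (cs ! i) \<inter> square w (cs ! j) \<noteq> {}}"

definition stream_alpha :: "int \<Rightarrow> (int \<times> int) list \<Rightarrow> nat" where
  "stream_alpha w cs = independence_number {..<length cs} (intersection_edges w cs)"

text \<open>The guard \<open>0 < c\<close> excludes nonpositive ratios, for which the two inequalities
  would be satisfied by the constant \<open>0\<close>.\<close>

definition approximates :: "real \<Rightarrow> nat \<Rightarrow> real \<Rightarrow> bool" where
  "approximates c a \<gamma> \<longleftrightarrow> 0 < c \<and> 1 / c * real a \<le> \<gamma> \<and> \<gamma> \<le> real a"

text \<open>Here \<open>b\<close> bounds the bit-length of the side length and of all coordinates.\<close>

definition square_stream :: "real \<Rightarrow> real \<Rightarrow> nat \<Rightarrow> int \<Rightarrow> (int \<times> int) list \<Rightarrow> bool" where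
  "square_stream \<delta> b n w cs \<longleftrightarrow>
     length cs = n \<and> 0 < w \<and> real_of_int (bitlen w) \<le> b \<and>
     (\<forall>(x, y) \<in> set cs. real_of_int (bitlen \<bar>x\<bar>) \<le> b \<and> real_of_int (bitlen \<bar>y\<bar>) \<le> b) \<and>
     (\<exists>u v :: real. \<forall>c \<in> set cs.
        square w c \<subseteq> {u .. u + (2 + \<delta>) * real_of_int w} \<times> {v .. v + (2 + \<delta>) * real_of_int w})"

text \<open>A randomized one-pass streaming algorithm is a deterministic one with access to a random
  tape drawn from \<open>tape\<close>. The tape can be read at any time and is not charged for; a lower
  bound in this model therefore also applies when random bits have to be stored. Memory
  contents are bit strings, \<open>start\<close> processes the side length, and \<open>update\<close> processes
  one center.\<close>

record 'r streaming_algorithm =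
  tape :: "'r measure"
  start :: "'r \<Rightarrow> int \<Rightarrow> bool list"
  update :: "'r \<Rightarrow> bool list \<Rightarrow> int \<times> int \<Rightarrow> bool list"
  result :: "'r \<Rightarrow> bool list \<Rightarrow> real"

definition memory_after ::
    "'r streaming_algorithm \<Rightarrow> 'r \<Rightarrow> int \<Rightarrow> (int \<times> int) list \<Rightarrow> bool list" where
  "memory_after A r w cs = foldl (update A r) (start A r w) cs"

text \<open>A non-measurable event has \<open>measure\<close> zero, so a positive lower bound on the
  following quantity includes measurability of the success event.\<close>

definition success_prob ::
    "'r streaming_algorithm \<Rightarrow> real \<Rightarrow> int \<Rightarrow> (int \<times> int) list \<Rightarrow> real" where
  "success_prob A c w cs =
     measure (tape A)
       {r \<in> space (tape A). approximates c (stream_alpha w cs) (result A r (memory_after A r w cs))}"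

definition uses_space ::
    "'r streaming_algorithm \<Rightarrow> int \<Rightarrow> (int \<times> int) list \<Rightarrow> nat \<Rightarrow> bool" where
  "uses_space A w cs s \<longleftrightarrow>
     (\<forall>r \<in> space (tape A). \<forall>t \<le> length cs. length (memory_after A r w (take t cs)) \<le> s)"

end

theory Submission imports Defs begin

text \<open>
  The lower bound is a reduction from the one-way communication problem INDEX. Alice encodes a
  set \<open>S \<subseteq> {0, \<dots>, m - 1}\<close> by squares centered at \<open>(i, m - i)\<close> for \<open>i \<in> S\<close>; they intersect each
  other because \<open>m < w\<close>. To query \<open>j\<close>, Bob appends two disjoint squares, one
  disjoint exactly from Alice's squares with \<open>i \<le> j\<close> and one disjoint exactly from those with
  \<open>i \<ge> j\<close>. So the independence number is 3 if \<open>j \<in> S\<close> and 2 otherwise, and an approximation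
  ratio below \<open>3/2\<close> tells the two cases apart. Coordinates of at most \<open>log\<^sub>2 n\<close> bits leave room for
  \<open>m\<close> linear in \<open>n\<close>.

  For INDEX, fix a random tape on which at least a fraction \<open>p\<close> of all queries \<open>(S, j)\<close> is
  answered correctly. For a fixed message, the answers form a fixed set, and the number of its
  agreements minus disagreements with a uniformly random \<open>S\<close> has moment generating function
  \<open>cosh(x)\<^sup>m \<le> exp(x\<^sup>2 m)\<close>. Summing over all messages and applying Jensen's inequality shows that
  the number of messages is exponential in \<open>m\<close>.
\<close>

section \<open>Moment generating function of the agreement count\<close>

text \<open>Expanding the product on the right selects one summand for each \<open>j\<close>;
  \<open>S\<close> records where \<open>a j\<close> is selected.\<close>

lemma sum_Pow_prod_if:
  fixes a b :: "'a \<Rightarrow> 'b::comm_semiring_1"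
  assumes "finite V"
  shows "(\<Sum>S\<in>Pow V. \<Prod>j\<in>V. if j \<in> S then a j else b j) = (\<Prod>j\<in>V. a j + b j)"
proof -
  have "(\<Prod>j\<in>V. if j \<in> S then a j else b j) = prod a S * prod b (V - S)" if "S \<in> Pow V" for S
  proof -
    have "V \<inter> {j. j \<in> S} = S" "V \<inter> - {j. j \<in> S} = V - S" using that by auto
    then show ?thesis using assms by (simp add: prod.If_cases)
  qed
  then show ?thesis using prod_add[OF assms, of a b] by simp
qed

lemma exp_plus_exp_minus_le:
  fixes x :: real
  assumes "0 \<le> x" "x \<le> 1"
  shows "exp x + exp (- x) \<le> 2 * exp (x\<^sup>2)"
proof -
  have up: "exp x \<le> 1 + x + x\<^sup>2" using assms by (rule exp_bound)
  \<comment> \<open>The product equals \<open>1 + x^3\<close>; replacing \<open>1 + x\<close> by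
    \<open>exp x\<close> then bounds \<open>exp (- x)\<close>.\<close>
  have "1 \<le> (1 - x + x\<^sup>2) * (1 + x)"
    using assms by (simp add: algebra_simps power2_eq_square)
  also have "\<dots> \<le> (1 - x + x\<^sup>2) * exp x"
    using assms by (intro mult_left_mono) auto
  finally have "exp (- x) \<le> 1 - x + x\<^sup>2"
    by (simp add: exp_minus field_simps)
  with up have "exp x + exp (- x) \<le> 2 * (1 + x\<^sup>2)" by simp
  also have "\<dots> \<le> 2 * exp (x\<^sup>2)"
    by (intro mult_left_mono exp_ge_add_one_self) simp
  finally show ?thesis .
qed

text \<open>This is \<open>card V\<close> minus the Hamming distance on \<open>V\<close>.
  \<open>Y\<close> may contain elements outside \<open>V\<close>, as decoded sets do.\<close>

definition agreement :: "'a set \<Rightarrow> 'a set \<Rightarrow> 'a set \<Rightarrow> nat" where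
  "agreement V S Y = card {j \<in> V. j \<in> S \<longleftrightarrow> j \<in> Y}"

lemma agreement_eq_sum:
  assumes "finite V"
  shows "real (agreement V S Y) = (\<Sum>j\<in>V. if j \<in> S \<longleftrightarrow> j \<in> Y then 1 else 0)"
  using assms by (simp add: agreement_def sum.If_cases Int_def)

text \<open>For uniformly random \<open>S\<close>, agreements minus disagreements is a sum of
  independent signs whatever \<open>Y\<close> is, so the exponential sum factors over
  \<open>V\<close>.\<close>

lemma sum_Pow_exp_agreement_le:
  fixes x :: real
  assumes "finite V" "0 \<le> x" "x \<le> 1"
  shows "(\<Sum>S\<in>Pow V. exp (x * (2 * real (agreement V S Y) - real (card V))))
    \<le> 2 ^ card V * exp (x\<^sup>2 * card V)"
proof -
  have "exp (x * (2 * real (agreement V S Y) - real (card V))) =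
      (\<Prod>j\<in>V. if j \<in> S then exp (if j \<in> Y then x else - x) else exp (if j \<in> Y then - x else x))" for S
  proof -
    have "x * (2 * real (agreement V S Y) - real (card V))
      = (\<Sum>j\<in>V. x * (2 * (if j \<in> S \<longleftrightarrow> j \<in> Y then 1 else 0) - 1))"
      unfolding agreement_eq_sum[OF assms(1)]
      by (simp add: sum_distrib_left[symmetric] sum_subtractf)
    then show ?thesis
      using assms(1) by (auto simp: exp_sum intro!: prod.cong)
  qed
  then have "(\<Sum>S\<in>Pow V. exp (x * (2 * real (agreement V S Y) - real (card V))))
     = (\<Prod>j\<in>V. exp (if j \<in> Y then x else - x) + exp (if j \<in> Y then - x else x))"
    by (simp only: sum_Pow_prod_if[OF assms(1)])
  also have "\<dots> = (exp x + exp (- x)) ^ card V"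
    by (subst prod_constant[symmetric], intro prod.cong) auto
  also have "\<dots> \<le> (2 * exp (x\<^sup>2)) ^ card V"
    using exp_plus_exp_minus_le[OF assms(2,3)] by (intro power_mono) (auto intro: add_nonneg_nonneg)
  also have "\<dots> = 2 ^ card V * exp (x\<^sup>2 * card V)"
    by (simp add: power_mult_distrib exp_of_nat_mult[symmetric] mult.commute)
  finally show ?thesis .
qed

section \<open>Lower bound for INDEX\<close>

text \<open>\<open>f\<close> is the message map and \<open>g\<close> the decoder. High average
  agreement makes the exponential sum large, while each fixed message accounts for little of
  it.\<close>

lemma index_message_count:
  fixes f :: "'a set \<Rightarrow> 'b" and g :: "'b \<Rightarrow> 'a set" and p :: real
  assumes V: "finite V" and p: "1 / 2 \<le> p" "p \<le> 1"
    and N: "card (f ` Pow V) \<le> N"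
    and avg: "p * card V * 2 ^ card V \<le> (\<Sum>S\<in>Pow V. real (agreement V S (g (f S))))"
  shows "(2 * p - 1)\<^sup>2 / 4 * card V \<le> ln (real N)"
proof -
  \<comment> \<open>This value maximizes \<open>x * (2 * p - 1) - x^2\<close>, the final bound on
    \<open>ln N\<close> per element of \<open>V\<close>. The number \<open>a\<close> below bounds
    the mean of \<open>z\<close> from below.\<close>
  define x where "x = (2 * p - 1) / 2"
  have x: "0 \<le> x" "x \<le> 1" using p by (auto simp: x_def)
  define z where "z S = x * (2 * real (agreement V S (g (f S))) - real (card V))" for S
  define a where "a = 2 * x\<^sup>2 * card V"
  have finP: "finite (Pow V)" and cardP: "card (Pow V) = 2 ^ card V"
    using V by (auto simp: card_Pow)
  have Npos: "N > 0"
  proof -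
    have "f ` Pow V \<noteq> {}" "finite (f ` Pow V)" using finP by auto
    then show ?thesis using N by (metis card_gt_0_iff le_zero_eq not_gr_zero)
  qed
  have "2 ^ card V * a \<le> (\<Sum>S\<in>Pow V. z S)"
  proof -
    have "(\<Sum>S\<in>Pow V. z S) = x * (2 * (\<Sum>S\<in>Pow V. real (agreement V S (g (f S)))) - 2 ^ card V * card V)"
      by (simp add: z_def sum_distrib_left[symmetric] sum_subtractf cardP)
    also have "\<dots> \<ge> x * (2 * (p * card V * 2 ^ card V) - 2 ^ card V * card V)"
      using avg x by (intro mult_left_mono) auto
    also have "x * (2 * (p * card V * 2 ^ card V) - 2 ^ card V * card V) = 2 ^ card V * a"
      by (simp add: a_def x_def power2_eq_square field_simps)
    finally show ?thesis .
  qed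
  \<comment> \<open>Jensen's inequality for \<open>exp\<close>, via its tangent line at \<open>a\<close>.\<close>
  then have "2 ^ card V * exp a \<le> exp a * (\<Sum>S\<in>Pow V. 1 + (z S - a))"
    by (simp add: sum.distrib sum_subtractf cardP)
  also have "\<dots> = (\<Sum>S\<in>Pow V. exp a * (1 + (z S - a)))"
    by (simp add: sum_distrib_left)
  also have "\<dots> \<le> (\<Sum>S\<in>Pow V. exp (z S))"
  proof (rule sum_mono)
    fix S
    have "exp a * (1 + (z S - a)) \<le> exp a * exp (z S - a)"
      by (intro mult_left_mono exp_ge_add_one_self) auto
    then show "exp a * (1 + (z S - a)) \<le> exp (z S)" by (simp add: exp_diff)
  qed
  \<comment> \<open>Adding the positive terms of all other messages makes \<open>y\<close>
    independent of \<open>S\<close>.\<close>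
  also have "\<dots> \<le> (\<Sum>S\<in>Pow V. \<Sum>y\<in>f ` Pow V.
      exp (x * (2 * real (agreement V S (g y)) - real (card V))))"
    unfolding z_def
    by (intro sum_mono member_le_sum[of _ _ "\<lambda>y. exp (x * (2 * real (agreement V _ (g y)) - real (card V)))"])
       (use finP in auto)
  also have "\<dots> = (\<Sum>y\<in>f ` Pow V. \<Sum>S\<in>Pow V.
      exp (x * (2 * real (agreement V S (g y)) - real (card V))))"
    by (rule sum.swap)
  also have "\<dots> \<le> (\<Sum>y\<in>f ` Pow V. 2 ^ card V * exp (x\<^sup>2 * card V))"
    by (intro sum_mono sum_Pow_exp_agreement_le V x)
  also have "\<dots> \<le> real N * (2 ^ card V * exp (x\<^sup>2 * card V))"
    using N by (simp add: mult_right_mono)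
  finally have "2 ^ card V * exp a \<le> 2 ^ card V * (real N * exp (x\<^sup>2 * card V))"
    by (simp add: mult_ac)
  then have "exp a \<le> real N * exp (x\<^sup>2 * card V)" by simp
  then have "exp (a - x\<^sup>2 * card V) \<le> real N"
    by (simp add: exp_diff field_simps)
  then have "a - x\<^sup>2 * card V \<le> ln (real N)"
    using Npos by (simp add: ln_ge_iff)
  then show ?thesis
    by (simp add: a_def x_def power_divide mult.commute)
qed

lemma card_bool_lists_le: "card {l :: bool list. length l \<le> s} \<le> 2 ^ (s + 1)"
proof -
  have "card {l :: bool list. length l \<le> s} = (\<Sum>i\<le>s. 2 ^ i)"
    using card_lists_length_le[of "UNIV :: bool set" s] by simp
  also have "\<dots> \<le> 2 ^ (s + 1)"
    using sum_power2[of "Suc s"] by (simp add: atLeast0LessThan lessThan_Suc_atMost)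
  finally show ?thesis .
qed

lemma finite_bool_lists_le: "finite {l :: bool list. length l \<le> s}"
  using finite_lists_length_le[of "UNIV :: bool set" s] by simp

text \<open>Averaging over the tape: the expected number of successful queries is at least a
  fraction \<open>p\<close> of all, so some tape attains it. Fixing that tape gives a deterministic
  protocol.\<close>

lemma (in prob_space) index_lower_bound:
  fixes p :: real and msg :: "'a \<Rightarrow> 'b set \<Rightarrow> bool list" and dec :: "'a \<Rightarrow> bool list \<Rightarrow> 'b set"
  assumes V: "finite V" and p: "1 / 2 < p"
    and len: "\<And>r S. r \<in> space M \<Longrightarrow> S \<subseteq> V \<Longrightarrow> length (msg r S) \<le> s"
    and prob: "\<And>S j. S \<subseteq> V \<Longrightarrow> j \<in> V \<Longrightarrow> p \<le> prob {r \<in> space M. Q r S j}"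
    and dec: "\<And>r S j. r \<in> space M \<Longrightarrow> S \<subseteq> V \<Longrightarrow> j \<in> V \<Longrightarrow> Q r S j \<Longrightarrow>
      j \<in> S \<longleftrightarrow> j \<in> dec r (msg r S)"
  shows "(2 * p - 1)\<^sup>2 / 4 * card V \<le> (real s + 1) * ln 2"
proof (cases "V = {}")
  case False
  then obtain j0 where "j0 \<in> V" by auto
  then have p1: "p \<le> 1" using prob[of "{}" j0] prob_le_1 by (meson empty_subsetI order_trans)
  let ?E = "\<lambda>S j. {r \<in> space M. Q r S j}"
  \<comment> \<open>A non-measurable event would have measure zero, which is below
    \<open>p\<close>.\<close>
  have meas: "?E S j \<in> events" if "S \<subseteq> V" "j \<in> V" for S j
    using prob[OF that] p measure_notin_sets by fastforce
  define X where "X r = (\<Sum>S\<in>Pow V. \<Sum>j\<in>V. indicat_real (?E S j) r)" for r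
  have int: "integrable M X"
    unfolding X_def using meas
    by (intro Bochner_Integration.integrable_sum) (auto intro!: integrable_real_indicator simp: emeasure_eq_measure)
  have "expectation X = (\<Sum>S\<in>Pow V. \<Sum>j\<in>V. prob (?E S j))"
    unfolding X_def using meas
    by (subst Bochner_Integration.integral_sum |
        (auto intro!: sum.cong Bochner_Integration.integrable_sum integrable_real_indicator simp: emeasure_eq_measure))+
  also have "\<dots> \<ge> (\<Sum>S\<in>Pow V. \<Sum>j\<in>V. p)"
    using prob by (intro sum_mono) auto
  also have "(\<Sum>S\<in>Pow V. \<Sum>j\<in>V. p) = p * card V * 2 ^ card V"
    using V by (simp add: card_Pow)
  finally have "p * card V * 2 ^ card V \<le> expectation X" .
  then have "\<not> (AE r in M. X r < p * card V * 2 ^ card V)"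
    using expectation_less[OF int] by force
  then obtain r where r: "r \<in> space M" "p * card V * 2 ^ card V \<le> X r"
    by (meson AE_I2 not_le)
  \<comment> \<open>Only an inequality, since success implies a correct decoding but not
    conversely.\<close>
  have "X r \<le> (\<Sum>S\<in>Pow V. real (agreement V S (dec r (msg r S))))"
    unfolding X_def agreement_eq_sum[OF V]
    using dec[OF r(1)] by (intro sum_mono) (auto simp: indicator_def)
  with r have avg: "p * card V * 2 ^ card V \<le> (\<Sum>S\<in>Pow V. real (agreement V S (dec r (msg r S))))"
    by simp
  have "card (msg r ` Pow V) \<le> card {l :: bool list. length l \<le> s}"
    using len[OF r(1)] by (intro card_mono finite_bool_lists_le) auto
  also note card_bool_lists_le
  finally have "card (msg r ` Pow V) \<le> 2 ^ (s + 1)" .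
  from index_message_count[OF V _ p1 this avg] p
  have "(2 * p - 1)\<^sup>2 / 4 * card V \<le> ln (real (2 ^ (s + 1)))" by simp
  also have "\<dots> = (real s + 1) * ln 2"
    by (simp add: ln_mult ln_realpow algebra_simps)
  finally show ?thesis .
qed simp

section \<open>Independence number of the hard streams\<close>

text \<open>Closed squares that touch do intersect, hence the strict inequalities and the
  \<open>+ 1\<close> in \<open>bob_centers\<close>.\<close>

lemma square_disjoint_iff:
  assumes "0 \<le> w"
  shows "square w c \<inter> square w d = {} \<longleftrightarrow> w < \<bar>fst c - fst d\<bar> \<or> w < \<bar>snd c - snd d\<bar>"
proof -
  have "square w c \<inter> square w d = {} \<longleftrightarrow>
    real_of_int w < \<bar>real_of_int (fst c) - real_of_int (fst d)\<bar> \<or>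
    real_of_int w < \<bar>real_of_int (snd c) - real_of_int (snd d)\<bar>"
    using assms unfolding square_def Times_Int_Times Int_atLeastAtMost
    by (auto simp: times_eq_iff)
  also have "\<dots> \<longleftrightarrow> w < \<bar>fst c - fst d\<bar> \<or> w < \<bar>snd c - snd d\<bar>"
    by linarith
  finally show ?thesis .
qed

lemma intersection_edge_iff:
  assumes "i < length cs" "j < length cs" "i \<noteq> j" "0 \<le> w"
  shows "{i, j} \<notin> intersection_edges w cs \<longleftrightarrow>
    w < \<bar>fst (cs ! i) - fst (cs ! j)\<bar> \<or> w < \<bar>snd (cs ! i) - snd (cs ! j)\<bar>"
  unfolding square_disjoint_iff[OF assms(4), symmetric] using assms
  by (auto simp: intersection_edges_def doubleton_eq_iff)

lemma finite_independent_sets: "finite V \<Longrightarrow> finite {I. independent_set V E I}"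
  by (rule finite_subset[of _ "Pow V"]) (auto simp: independent_set_def)

lemma independence_number_ge:
  "finite V \<Longrightarrow> independent_set V E I \<Longrightarrow> card I \<le> independence_number V E"
  unfolding independence_number_def by (intro Max_ge) (auto intro: finite_independent_sets)

lemma independence_number_le:
  assumes "finite V" "\<And>I. independent_set V E I \<Longrightarrow> card I \<le> b"
  shows "independence_number V E \<le> b"
proof -
  have "independent_set V E {}" by (simp add: independent_set_def)
  then show ?thesis
    unfolding independence_number_def using assms
    by (subst Max_le_iff) (auto intro: finite_independent_sets)
qed

text \<open>The square at \<open>(m + 1, m + 1)\<close> intersects all other squares of the stream; it also pads the
  stream to the prescribed length.\<close>

definition alice_center :: "nat \<Rightarrow> nat set \<Rightarrow> nat \<Rightarrow> int \<times> int" where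
  "alice_center m S i = (if i \<in> S then (int i, int m - int i) else (int m + 1, int m + 1))"

text \<open>Relative to \<open>(i, m - i)\<close>, the first center is \<open>w + 1 + j - i\<close>
  away horizontally and the second \<open>w + 1 + i - j\<close> vertically; these exceed
  \<open>w\<close> iff \<open>i <= j\<close> and \<open>j <= i\<close>, respectively.\<close>

definition bob_centers :: "nat \<Rightarrow> int \<Rightarrow> nat \<Rightarrow> (int \<times> int) list" where
  "bob_centers m w j = [(w + int j + 1, 0), (0, w + int m - int j + 1)]"

text \<open>The first \<open>l\<close> squares are independent of \<open>j\<close>, so the memory
  after them can serve as Alice's message.\<close>

definition index_stream :: "nat \<Rightarrow> nat \<Rightarrow> int \<Rightarrow> nat set \<Rightarrow> nat \<Rightarrow> (int \<times> int) list" where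
  "index_stream l m w S j = map (alice_center m S) [0..<l] @ bob_centers m w j"

lemma length_index_stream [simp]: "length (index_stream l m w S j) = l + 2"
  by (simp add: index_stream_def bob_centers_def)

lemma nth_index_stream:
  "i < l \<Longrightarrow> index_stream l m w S j ! i = alice_center m S i"
  "index_stream l m w S j ! l = (w + int j + 1, 0)"
  "index_stream l m w S j ! Suc l = (0, w + int m - int j + 1)"
  by (auto simp: index_stream_def bob_centers_def nth_append)

lemma alice_center_cases:
  assumes "S \<subseteq> {..<m}"
  obtains "i \<in> S" "i < m" "alice_center m S i = (int i, int m - int i)"
  | "i \<notin> S" "alice_center m S i = (int m + 1, int m + 1)"
  using assms by (cases "i \<in> S") (auto simp: alice_center_def)

text \<open>The square for \<open>j\<close> and both of Bob's squares are pairwise disjoint.\<close>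

lemma stream_alpha_ge_3:
  assumes "S \<subseteq> {..<m}" "m \<le> l" "j \<in> S" "0 \<le> w"
  shows "3 \<le> stream_alpha w (index_stream l m w S j)"
proof -
  let ?cs = "index_stream l m w S j"
  have j: "j < m" "j < l" using assms by auto
  have "{j, l} \<notin> intersection_edges w ?cs" "{j, Suc l} \<notin> intersection_edges w ?cs"
    "{l, Suc l} \<notin> intersection_edges w ?cs"
    using assms j
    by (subst intersection_edge_iff; simp add: nth_index_stream alice_center_def)+
  \<comment> \<open>Independence also quantifies over equal vertices.\<close>
  moreover have "{i} \<notin> intersection_edges w ?cs" for i
    by (auto simp: intersection_edges_def)
  ultimately have "independent_set {..<length ?cs} (intersection_edges w ?cs) {j, l, Suc l}"
    using j by (auto simp: independent_set_def insert_commute)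
  from independence_number_ge[OF _ this] show ?thesis
    using j by (simp add: stream_alpha_def)
qed

text \<open>Alice's squares form a clique, and none of them is disjoint from both of Bob's. The
  padding square differs from other centers by up to \<open>m + 1\<close> in a coordinate, which is
  why \<open>w\<close> must be that large.\<close>

lemma stream_alpha_le_2:
  assumes S: "S \<subseteq> {..<m}" and j: "j < m" "j \<notin> S" and w: "int m + 1 \<le> w"
  shows "stream_alpha w (index_stream l m w S j) \<le> 2"
  unfolding stream_alpha_def
proof (rule independence_number_le)
  let ?cs = "index_stream l m w S j"
  fix I assume I: "independent_set {..<length ?cs} (intersection_edges w ?cs) I"
  have sub: "I \<subseteq> {..<l} \<union> {l, Suc l}"
    using I by (auto simp: independent_set_def)
  have far: "w < \<bar>fst (?cs ! a) - fst (?cs ! b)\<bar> \<or> w < \<bar>snd (?cs ! a) - snd (?cs ! b)\<bar>"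
    if "a \<in> I" "b \<in> I" "a \<noteq> b" for a b
  proof -
    have "{a, b} \<notin> intersection_edges w ?cs" "a < length ?cs" "b < length ?cs"
      using I that by (auto simp: independent_set_def)
    then show ?thesis using intersection_edge_iff[of a ?cs b w] that w by simp
  qed
  have alice: "a = b" if "a \<in> I" "b \<in> I" "a < l" "b < l" for a b
  proof (rule ccontr)
    assume "a \<noteq> b"
    from far[OF that(1,2) this] that w show False
      by (cases rule: alice_center_cases[OF S, of a]; cases rule: alice_center_cases[OF S, of b])
         (auto simp: nth_index_stream)
  qed
  have bob: "\<not> (l \<in> I \<and> Suc l \<in> I)" if "a \<in> I" "a < l" for a
  proof
    assume "l \<in> I \<and> Suc l \<in> I"
    then have "w < \<bar>fst (?cs ! a) - fst (?cs ! l)\<bar> \<or> w < \<bar>snd (?cs ! a) - snd (?cs ! l)\<bar>"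
      "w < \<bar>fst (?cs ! a) - fst (?cs ! Suc l)\<bar> \<or> w < \<bar>snd (?cs ! a) - snd (?cs ! Suc l)\<bar>"
      using far that by auto
    \<comment> \<open>Distance from both of Bob's squares forces \<open>a <= j\<close> and
      \<open>j <= a\<close>; the padding square is far from neither.\<close>
    with that w j have "a \<in> S \<and> a = j"
      by (cases rule: alice_center_cases[OF S, of a])
         (auto simp: nth_index_stream abs_if split: if_splits)
    with j show False by auto
  qed
  show "card I \<le> 2"
  proof (cases "\<exists>a\<in>I. a < l")
    case True
    then obtain a where a: "a \<in> I" "a < l" by auto
    then have "I \<subseteq> {a, l} \<or> I \<subseteq> {a, Suc l}"
      using sub alice bob by blast
    moreover have "card {a, b} \<le> 2" for b :: nat by (simp add: card_insert_if)
    ultimately show ?thesis by (meson card_mono finite.emptyI finite.insertI order_trans)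
  next
    case False
    then have "I \<subseteq> {l, Suc l}" using sub by auto
    then have "card I \<le> card {l, Suc l}" by (intro card_mono) auto
    then show ?thesis by simp
  qed
qed simp

section \<open>Admissibility of the hard streams\<close>

text \<open>For positive \<open>x\<close>, the bit-length is at most \<open>log 2 x + 1\<close>; the
  factor \<open>1 / 2\<close> in the hypothesis absorbs the \<open>+ 1\<close>.\<close>

lemma bitlen_le_log2:
  assumes "0 \<le> x" "real_of_int x \<le> real n / 2" "2 \<le> n"
  shows "real_of_int (bitlen x) \<le> log 2 (real n)"
proof (cases "x = 0")
  case True
  then show ?thesis using assms by simp
next
  case False
  then have x: "0 < x" using assms by simp
  then have "real_of_int (bitlen x) \<le> log 2 (real_of_int x) + 1"
    by (simp add: bitlen_alt_def)
  also have "\<dots> = log 2 (2 * real_of_int x)"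
    using x by (simp add: log_mult)
  also have "\<dots> \<le> log 2 (real n)"
    using x assms by (subst log_le_cancel_iff) auto
  finally show ?thesis .
qed

text \<open>All center coordinates lie between \<open>0\<close> and \<open>w + m + 1\<close>, so a
  region of side \<open>2 * w + m + 1\<close> suffices.\<close>

lemma square_stream_index_stream:
  fixes \<delta> b :: real
  assumes S: "S \<subseteq> {..<m}" and j: "j < m" and w: "0 < w" "real m + 1 \<le> \<delta> * w"
    and b: "real_of_int (w + int m + 1) \<le> real n / 2" "log 2 (real n) \<le> b"
    and n: "n = l + 2"
  shows "square_stream \<delta> b n w (index_stream l m w S j)"
proof -
  have box: "0 \<le> x \<and> x \<le> w + int m + 1 \<and> 0 \<le> y \<and> y \<le> w + int m + 1"
    if "(x, y) \<in> set (index_stream l m w S j)" for x y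
    using that S j w(1)
    by (auto simp: index_stream_def bob_centers_def alice_center_def split: if_splits)
  have bit: "real_of_int (bitlen x) \<le> b" if "0 \<le> x" "x \<le> w + int m + 1" for x
    using bitlen_le_log2[of x n] that b n by linarith
  have "square w c \<subseteq> {- w / 2 .. - w / 2 + (2 + \<delta>) * w} \<times> {- w / 2 .. - w / 2 + (2 + \<delta>) * w}"
    if c: "c \<in> set (index_stream l m w S j)" for c
  proof -
    obtain x y where xy: "c = (x, y)" by force
    have "0 \<le> x \<and> x \<le> w + int m + 1 \<and> 0 \<le> y \<and> y \<le> w + int m + 1"
      using box c xy by simp
    then have "real_of_int x + w / 2 \<le> - w / 2 + (2 + \<delta>) * w"
      "real_of_int y + w / 2 \<le> - w / 2 + (2 + \<delta>) * w"
      "- w / 2 \<le> real_of_int x - w / 2" "- w / 2 \<le> real_of_int y - w / 2"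
      using w(2) by (simp_all only: distrib_right) linarith+
    then show ?thesis
      unfolding square_def xy by (intro Sigma_mono) auto
  qed
  then have "\<exists>u v :: real. \<forall>c \<in> set (index_stream l m w S j).
      square w c \<subseteq> {u .. u + (2 + \<delta>) * w} \<times> {v .. v + (2 + \<delta>) * w}"
    by blast
  moreover have "\<forall>(x, y) \<in> set (index_stream l m w S j).
      real_of_int (bitlen \<bar>x\<bar>) \<le> b \<and> real_of_int (bitlen \<bar>y\<bar>) \<le> b"
    using box bit by (auto simp: abs_of_nonneg)
  moreover have "real_of_int (bitlen w) \<le> b" using bit[of w] w(1) by simp
  ultimately show ?thesis
    unfolding square_stream_def using w(1) n by simp
qed

section \<open>Reduction from INDEX to streaming\<close>

text \<open>The threshold \<open>2\<close> works because \<open>3 / (3 / 2 - \<epsilon>)\<close>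
  exceeds it, while an approximation never exceeds the true value.\<close>

lemma approximates_decides:
  assumes "approximates (3 / 2 - \<epsilon>) a \<gamma>" "0 < \<epsilon>"
  shows "3 \<le> a \<Longrightarrow> 2 < \<gamma>" "a \<le> 2 \<Longrightarrow> \<gamma> \<le> 2"
proof -
  have c: "0 < 3 / 2 - \<epsilon>" "1 / (3 / 2 - \<epsilon>) * real a \<le> \<gamma>" "\<gamma> \<le> real a"
    using assms by (auto simp: approximates_def)
  then show "\<gamma> \<le> 2" if "a \<le> 2" using that by linarith
  show "2 < \<gamma>" if "3 \<le> a"
  proof -
    have "2 < 1 / (3 / 2 - \<epsilon>) * 3" using c(1) assms(2) by (simp add: field_simps)
    also have "\<dots> \<le> 1 / (3 / 2 - \<epsilon>) * real a" using c(1) that by (intro mult_left_mono) auto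
    finally show ?thesis using c by simp
  qed
qed

text \<open>Bob resumes the algorithm from Alice's memory contents, feeds in his two squares and
  compares the result with \<open>2\<close>.\<close>

lemma streaming_space_lower_bound:
  fixes A :: "'r streaming_algorithm" and \<epsilon> \<delta> p b :: real
  assumes \<epsilon>: "0 < \<epsilon>" and p: "1 / 2 < p" and ps: "prob_space (tape A)"
    and w: "0 < w" "int m + 1 \<le> w" "real m + 1 \<le> \<delta> * w"
    and n: "n = l + 2" "m \<le> l" "real_of_int (w + int m + 1) \<le> real n / 2" "log 2 (real n) \<le> b"
    and succ: "\<And>cs. square_stream \<delta> b n w cs \<Longrightarrow> p \<le> success_prob A (3 / 2 - \<epsilon>) w cs"
    and space: "\<And>cs. square_stream \<delta> b n w cs \<Longrightarrow> uses_space A w cs s"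
  shows "(2 * p - 1)\<^sup>2 / 4 * real m \<le> (real s + 1) * ln 2"
proof (cases "m = 0")
  case False
  interpret prob_space "tape A" by (rule ps)
  let ?cs = "index_stream l m w"
  have str: "square_stream \<delta> b n w (?cs S j)" if "S \<subseteq> {..<m}" "j < m" for S j
    using that w n by (intro square_stream_index_stream) auto
  define msg where "msg r S = memory_after A r w (map (alice_center m S) [0..<l])" for r S
  define dec where "dec r \<mu> = {j. 2 < result A r (foldl (update A r) \<mu> (bob_centers m w j))}" for r \<mu>
  have final: "memory_after A r w (?cs S j) = foldl (update A r) (msg r S) (bob_centers m w j)" for r S j
    by (simp add: msg_def memory_after_def index_stream_def)
  define Q where "Q r S j \<longleftrightarrow> approximates (3 / 2 - \<epsilon>) (stream_alpha w (?cs S j))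
      (result A r (memory_after A r w (?cs S j)))" for r S j
  have "(2 * p - 1)\<^sup>2 / 4 * card {..<m} \<le> (real s + 1) * ln 2"
  proof (rule index_lower_bound[where msg = msg and dec = dec and Q = Q])
    fix r S assume "r \<in> space (tape A)" "S \<subseteq> {..<m}"
    \<comment> \<open>The message is the memory at a prefix common to all queries, so query
      \<open>0\<close> serves; it exists because \<open>m\<close> is nonzero.\<close>
    then have "length (memory_after A r w (take l (?cs S 0))) \<le> s"
      using space[OF str[of S 0]] False by (auto simp: uses_space_def)
    then show "length (msg r S) \<le> s"
      by (simp add: msg_def index_stream_def)
  next
    fix S j assume "S \<subseteq> {..<m}" "j \<in> {..<m}"
    then show "p \<le> prob {r \<in> space (tape A). Q r S j}"
      using succ[OF str[of S j]] by (simp add: success_prob_def Q_def)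
  next
    fix r S j assume *: "S \<subseteq> {..<m}" "j \<in> {..<m}" "Q r S j"
    note approx = approximates_decides[OF *(3)[unfolded Q_def] \<epsilon>, unfolded final]
    show "j \<in> S \<longleftrightarrow> j \<in> dec r (msg r S)"
      using approx(1)[OF stream_alpha_ge_3[of S m l j w]] approx(2)[OF stream_alpha_le_2[of S m j w l]] * w n
      by (force simp: dec_def)
  qed (use p in auto)
  then show ?thesis by simp
qed simp

section \<open>Choice of parameters and asymptotics\<close>

theorem theorem12:
  fixes \<epsilon> \<delta> p C :: real and k :: nat
    and A :: "nat \<Rightarrow> 'r streaming_algorithm" and s :: "nat \<Rightarrow> nat"
  assumes "\<epsilon> > 0" and "\<delta> > 0" and "p > 1 / 2" and "C \<ge> 1" and "k \<ge> 1"
    and "\<And>n. prob_space (tape (A n))"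
    and "\<And>n w cs. square_stream \<delta> (C * log 2 (real n) ^ k) n w cs \<Longrightarrow>
           success_prob (A n) (3 / 2 - \<epsilon>) w cs \<ge> p"
    and "\<And>n w cs. square_stream \<delta> (C * log 2 (real n) ^ k) n w cs \<Longrightarrow>
           uses_space (A n) w cs (s n)"
  shows "(\<lambda>n. real (s n)) \<in> \<Omega>(\<lambda>n. real n)"
proof -
  obtain K :: nat where K: "1 \<le> K" "1 \<le> \<delta> * real K"
  proof -
    obtain K0 :: nat where "1 / \<delta> < real K0" using reals_Archimedean2 by blast
    then have "1 \<le> \<delta> * real (Suc K0)" using assms(2) by (simp add: field_simps)
    then show ?thesis using that[of "Suc K0"] by simp
  qed
  \<comment> \<open>With \<open>w = K * (m + 1)\<close>, the largest coordinate bound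
    \<open>w + m + 1\<close> is \<open>(K + 1) * (m + 1)\<close>. It must be at most
    \<open>n / 2\<close>, so \<open>m + 1\<close> can be \<open>n div D\<close>.\<close>
  define D where "D = 2 * K + 2"
  define a where "a = (2 * p - 1)\<^sup>2 / 4"
  have apos: "0 < a" using assms(3) by (simp add: a_def)
  have main: "a * (real n / D - 2) \<le> real (s n) + 1" if n: "n \<ge> D" for n
  proof -
    define m where "m = n div D - 1"
    define q where "q = K * (m + 1)"
    define w where "w = int q"
    have "n div D \<ge> 1" using n K by (simp add: D_def div_greater_zero_iff Suc_le_eq)
    then have m1: "m + 1 = n div D" by (simp add: m_def)
    have size: "2 * ((K + 1) * (m + 1)) \<le> n"
      unfolding m1 using div_times_less_eq_dividend[of n D] by (simp add: D_def algebra_simps)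
    have Km: "m + 1 \<le> q" using mult_le_mono1[OF K(1), of "m + 1"] by (simp add: q_def)
    have size4: "2 * q + 2 * (m + 1) \<le> n" using size by (simp add: q_def algebra_simps)
    \<comment> \<open>This leaves two positions for Bob, as \<open>m <= n - 2\<close>, and makes the
      logarithm at least \<open>1\<close>, so that its powers increase.\<close>
    have n4: "4 * (m + 1) \<le> n" using size4 Km by simp
    have "log 2 (real n) \<ge> 1" using n4 by (simp add: le_log_iff)
    then have "1 * log 2 (real n) ^ 1 \<le> C * log 2 (real n) ^ k"
      using assms(4,5) by (intro mult_mono power_increasing) auto
    then have "log 2 (real n) \<le> C * log 2 (real n) ^ k" by simp
    moreover have "real m + 1 \<le> \<delta> * real_of_int w"
    proof -
      have "1 * (real m + 1) \<le> (\<delta> * real K) * (real m + 1)" using K by (intro mult_right_mono) auto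
      then show ?thesis by (simp add: w_def q_def algebra_simps)
    qed
    moreover have "real_of_int (w + int m + 1) \<le> real n / 2"
    proof -
      have "real (2 * q + 2 * (m + 1)) \<le> real n" using size4 of_nat_le_iff by blast
      then show ?thesis by (simp add: w_def)
    qed
    moreover have "0 < w" "int m + 1 \<le> w" using Km by (auto simp: w_def)
    ultimately have "a * real m \<le> (real (s n) + 1) * ln 2"
      unfolding a_def using n4 assms
      by (intro streaming_space_lower_bound[where A = "A n" and n = n and l = "n - 2" and w = w
            and \<delta> = \<delta> and \<epsilon> = \<epsilon> and b = "C * log 2 (real n) ^ k"]) auto
    also have "\<dots> \<le> (real (s n) + 1) * 1"
      using ln_le_minus_one[of 2] by (intro mult_left_mono) auto
    finally have "a * real m \<le> real (s n) + 1" by simp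
    moreover have "real n / D \<le> real m + 2"
    proof -
      have "n \<le> D * (m + 2)"
        using dividend_less_div_times[of D n] m1 by (simp add: D_def algebra_simps flip: m1)
      then have "real n \<le> real D * (real m + 2)"
        by (metis of_nat_add of_nat_le_iff of_nat_mult of_nat_numeral)
      then show ?thesis by (simp add: D_def field_simps)
    qed
    then have "a * (real n / D - 2) \<le> a * real m" using apos by (intro mult_left_mono) auto
    ultimately show ?thesis by simp
  qed
  have Dpos: "0 < real D" by (simp add: D_def)
  \<comment> \<open>Half of the slope \<open>a / D\<close>; for large \<open>n\<close> the other
    half absorbs the constant \<open>2 * a + 1\<close>.\<close>
  define c where "c = a / (2 * D)"
  have cpos: "0 < c" using apos Dpos by (simp add: c_def)
  show ?thesis
  proof (rule landau_omega.bigI[OF cpos])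
    have "\<forall>\<^sub>F n in sequentially. n \<ge> max D (nat \<lceil>(2 * a + 1) / c\<rceil>)" by (rule eventually_ge_at_top)
    then show "\<forall>\<^sub>F n in sequentially. c * norm (real n) \<le> norm (real (s n))"
    proof eventually_elim
      case (elim n)
      then have "(2 * a + 1) / c \<le> real n" by linarith
      then have "2 * a + 1 \<le> c * real n" using cpos by (simp add: field_simps)
      moreover have "a * (real n / D - 2) = 2 * (c * real n) - 2 * a"
        using Dpos by (simp add: c_def field_simps)
      ultimately show ?case using main[of n] elim by simp
    qed
  qed
qed

end
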